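(* Consider an MDP-JLS with MDP $\mathcal{M}=(S,\hat{s},\Sigma,T)$, $S=\{s_1,\dots,s_N\}$, and mode matrices $A_1,\dots,A_N\in\mathbb{R}^{n\times n}$. Suppose there exist real numbers $\alpha_i>0$ and $K_{i,\sigma}\ge 0$ ($i\in\{1,\dots,N\}$, $\sigma\in\Sigma$, with $K_{i,\sigma}=0$ if $\sigma$ is not available at $s_i$) such that, with $V_i=\alpha_i I$, for all $i,j\in\{1,\dots,N\}$, $$V_j-\mathcal{T}_j(V)>0,\qquad \mathcal{T}_j(V)=\sum_{i=1}^N\sum_{\sigma\in\Sigma}T(i,\sigma,j)\,K_{i,\sigma}\,A_iA_i',\qquad \sum_{\sigma\in\Sigma}K_{i,\sigma}=\alpha_i .$$ Then the MJLS induced by the policy $\pi(i,\sigma)=K_{i,\sigma}/\alpha_i$ is mean-square stable.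
   Context: An MDP is a tuple $\mathcal{M}=(S,\hat{s},\Sigma,T)$ with finite state set $S=\{s_1,\dots,s_N\}$, initial state $\hat s\in S$, finite action set $\Sigma$, and transition function $T:S\times\Sigma\times S\to[0,1]$, $T(s,\sigma,s')=p(s'|s,\sigma)$; write $T(i,\sigma,j)$ for $T(s_i,\sigma,s_j)$. If $\sigma$ is available at $s_i$ then $T(i,\sigma,\cdot)$ is a probability distribution; if $\sigma$ is not available at $s_i$ then $T(i,\sigma,j)=0$ for all $j$, and policies do not select it. A (randomized) policy $\pi:S\times\Sigma\to[0,1]$ gives the probability $\pi(i,\sigma)$ of taking action $\sigma$ at $s_i$. Under $\pi$ the MDP reduces to a discrete-time Markov chain (DTMC) $(S,\hat s,P)$ with $P_{ij}=\sum_{\sigma}T(i,\sigma,j)\pi(i,\sigma)$. An MDP-JLS is the switched system $x(k+1)=A_{s_k}x(k)$, $x(k)\in\mathbb{R}^n$, with matrix $A_i\in\mathbb{R}^{n\times n}$ used when the mode at time $k$ is $s_i$, and with the mode process governed by $\mathcal{M}$. Given a policy $\pi$, it becomes a Markov jump linear system (MJLS): the modes follow the induced DTMC. An MJLS is mean-square stable if $\lim_{k\to\infty}\|E[x(k)x'(k)]\|_\infty=0$ for any initial condition $x_0$. Here $'$ denotes transpose, $I$ is the $n\times n$ identity, and $A>0$ means $A$ is (symmetric) positive definite. *)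

theory Defs
  imports "HOL-Probability.Probability"
begin

text \<open>
  Modes and actions are the elements of arbitrary finite types. The set \<open>avail s\<close> contains the
  actions available at \<open>s\<close>; rows of \<open>T\<close> for unavailable actions vanish. The initial state is an
  arbitrary element of the mode type and enters only through the induced Markov chain.
\<close>

definition is_mdp :: "('s::finite \<Rightarrow> 'a::finite set) \<Rightarrow> ('s \<Rightarrow> 'a \<Rightarrow> 's \<Rightarrow> real) \<Rightarrow> bool" where
  "is_mdp avail T \<longleftrightarrow>
     (\<forall>s a s'. 0 \<le> T s a s' \<and> T s a s' \<le> 1) \<and>
     (\<forall>s. \<forall>a\<in>avail s. (\<Sum>s'\<in>UNIV. T s a s') = 1) \<and>
     (\<forall>s a s'. a \<notin> avail s \<longrightarrow> T s a s' = 0)"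

definition is_policy :: "('s::finite \<Rightarrow> 'a::finite set) \<Rightarrow> ('s \<Rightarrow> 'a \<Rightarrow> real) \<Rightarrow> bool" where
  "is_policy avail pol \<longleftrightarrow>
     (\<forall>s a. 0 \<le> pol s a \<and> pol s a \<le> 1) \<and>
     (\<forall>s. (\<Sum>a\<in>UNIV. pol s a) = 1) \<and>
     (\<forall>s a. a \<notin> avail s \<longrightarrow> pol s a = 0)"

definition induced_transition ::
    "('s::finite \<Rightarrow> 'a::finite \<Rightarrow> 's \<Rightarrow> real) \<Rightarrow> ('s \<Rightarrow> 'a \<Rightarrow> real) \<Rightarrow> 's \<Rightarrow> 's \<Rightarrow> real" where
  "induced_transition T pol i j = (\<Sum>a\<in>UNIV. T i a j * pol i a)"

text \<open>
  The process \<open>X\<close> on the probability space \<open>M\<close> is a time-homogeneous Markov chain started in \<open>s0\<close>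
  with transition matrix \<open>P\<close>. Only the values of \<open>w\<close> up to \<open>Suc k\<close> matter.
\<close>

definition is_dtmc ::
    "'w measure \<Rightarrow> (nat \<Rightarrow> 'w \<Rightarrow> 's::finite) \<Rightarrow> 's \<Rightarrow> ('s \<Rightarrow> 's \<Rightarrow> real) \<Rightarrow> bool" where
  "is_dtmc M X s0 P \<longleftrightarrow>
     prob_space M \<and>
     (\<forall>k. X k \<in> measurable M (count_space UNIV)) \<and>
     (AE \<omega> in M. X 0 \<omega> = s0) \<and>
     (\<forall>k w. \<P>(\<omega> in M. \<forall>i\<le>k. X i \<omega> = w i) \<noteq> 0 \<longrightarrow>
        \<P>(\<omega> in M. X (Suc k) \<omega> = w (Suc k) \<bar> \<forall>i\<le>k. X i \<omega> = w i) = P (w k) (w (Suc k)))"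

primrec jls_state ::
    "('s \<Rightarrow> real^'n^'n) \<Rightarrow> (nat \<Rightarrow> 's) \<Rightarrow> real^'n \<Rightarrow> nat \<Rightarrow> real^'n" where
  "jls_state A s x0 0 = x0"
| "jls_state A s x0 (Suc k) = A (s k) *v jls_state A s x0 k"

definition outer_product :: "real^'n \<Rightarrow> real^'n \<Rightarrow> real^'n^'n" where
  "outer_product x y = (\<chi> a b. x $ a * y $ b)"

text \<open>The matrix norm induced by the maximum norm on vectors, i.e. the maximal absolute row sum.\<close>

definition matrix_norm_inf :: "real^'n^'n \<Rightarrow> real" where
  "matrix_norm_inf Q = Max (range (\<lambda>a. \<Sum>b\<in>UNIV. \<bar>Q $ a $ b\<bar>))"

definition mean_square_stable ::
    "'w measure \<Rightarrow> (nat \<Rightarrow> 'w \<Rightarrow> 's) \<Rightarrow> ('s \<Rightarrow> real^'n^'n) \<Rightarrow> bool" where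
  "mean_square_stable M X A \<longleftrightarrow>
     (\<forall>x0. (\<lambda>k. matrix_norm_inf
        (\<integral>\<omega>. (let x = jls_state A (\<lambda>t. X t \<omega>) x0 k in outer_product x x) \<partial>M))
        \<longlonglongrightarrow> 0)"

definition pos_def :: "real^'n^'n \<Rightarrow> bool" where
  "pos_def Q \<longleftrightarrow> transpose Q = Q \<and> (\<forall>x. x \<noteq> 0 \<longrightarrow> 0 < x \<bullet> (Q *v x))"

end

theory Submission
  imports Defs
begin

text \<open>
  The second moments \<open>E[(y \<bullet> x(k))\<^sup>2; s\<^sub>k = j]\<close>, as quadratic forms in \<open>y\<close>, satisfy
  a linear recursion whose operator is monotone and sends the family \<open>y \<mapsto> \<alpha>\<^sub>j |y|\<^sup>2\<close> below
  \<open>\<rho>\<close> times itself; by compactness of the unit sphere and finiteness of the mode set, the Lyapunov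
  inequality provides one \<open>\<rho> < 1\<close> for all modes. Hence the moments decay geometrically.
\<close>

section \<open>Quadratic forms of matrices\<close>

text \<open>The form attains its minimum on the compact unit sphere, at a nonzero point, so this
  minimum is positive. Homogeneity of degree two carries the bound from the sphere to every
  \<open>y\<close>.\<close>

lemma pos_def_coercive:
  fixes Q :: "real^'n^'n"
  assumes "pos_def Q"
  obtains d where "0 < d" "\<And>y. d * (y \<bullet> y) \<le> y \<bullet> (Q *v y)"
proof -
  have "continuous_on (sphere 0 1) (\<lambda>y. y \<bullet> (Q *v y))"
    by (intro continuous_intros linear_continuous_on matrix_vector_mul_bounded_linear)
  moreover have "sphere (0::real^'n) 1 \<noteq> {}"
    by simp
  ultimately obtain u where u: "u \<in> sphere 0 1"
      and min: "\<And>y. y \<in> sphere 0 1 \<Longrightarrow> u \<bullet> (Q *v u) \<le> y \<bullet> (Q *v y)"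
    using continuous_attains_inf[OF compact_sphere, of 0 1 "\<lambda>y. y \<bullet> (Q *v y)"] by blast
  show thesis
  proof
    show "0 < u \<bullet> (Q *v u)"
      using assms u unfolding pos_def_def by (metis dist_self mem_sphere zero_neq_one)
    show "(u \<bullet> (Q *v u)) * (y \<bullet> y) \<le> y \<bullet> (Q *v y)" for y
    proof (cases "y = 0")
      case False
      define z where "z = (1 / norm y) *\<^sub>R y"
      have y: "y = norm y *\<^sub>R z" and z: "z \<in> sphere 0 1"
        using False by (auto simp: z_def)
      have "y \<bullet> (Q *v y) = (norm y)\<^sup>2 * (z \<bullet> (Q *v z))"
        by (subst (1 2) y) (simp add: matrix_vector_mult_scaleR power2_eq_square)
      moreover have "(u \<bullet> (Q *v u)) * (norm y)\<^sup>2 \<le> (z \<bullet> (Q *v z)) * (norm y)\<^sup>2"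
        using min[OF z] by (intro mult_right_mono) auto
      ultimately show ?thesis
        by (simp add: power2_norm_eq_inner mult.commute)
    qed simp
  qed
qed

text \<open>Adjointness moves one factor \<open>B\<close> to the other side. This turns the summands
  \<open>A i ** transpose (A i)\<close> of the Lyapunov inequality into the squared norms that arise
  in the moment recursion.\<close>

lemma inner_outer_square_mult:
  fixes B :: "real^'n^'m" and y :: "real^'m"
  shows "y \<bullet> ((B ** transpose B) *v y) = (transpose B *v y) \<bullet> (transpose B *v y)"
  by (simp add: matrix_vector_mul_assoc[symmetric] dot_lmul_matrix[symmetric])

lemma matrix_vector_mult_sum_left:
  fixes B :: "'i \<Rightarrow> real^'n^'m"
  shows "(\<Sum>i\<in>I. B i) *v y = (\<Sum>i\<in>I. B i *v y)"
  by (induction I rule: infinite_finite_induct) (auto simp: matrix_vector_mult_add_rdistrib)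

section \<open>Functions of finitely many modes of the path\<close>

lemma jls_state_cong:
  assumes "\<And>t. t < k \<Longrightarrow> s t = s' t"
  shows "jls_state A s x0 k = jls_state A s' x0 k"
  using assms by (induction k) auto

lemma finite_paths: "finite (PiE {..k::nat} (\<lambda>_. UNIV :: 's::finite set))"
  by (intro finite_PiE) auto

text \<open>There are finitely many paths of length \<open>k + 1\<close>, and their cylinders
  partition the space, so such a function of the modes is simple. The extensional functions in
  \<open>PiE\<close> supply exactly one representative per path.\<close>

lemma path_function_decomposition:
  fixes X :: "nat \<Rightarrow> 'w \<Rightarrow> 's::finite" and G :: "(nat \<Rightarrow> 's) \<Rightarrow> 'b::real_vector"
  assumes "\<omega> \<in> space M"
    and dep: "\<forall>u v. (\<forall>t\<le>k. u t = v t) \<longrightarrow> G u = G v"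
  shows "G (\<lambda>t. X t \<omega>) =
    (\<Sum>w\<in>PiE {..k} (\<lambda>_. UNIV). indicat_real {\<omega>\<in>space M. \<forall>t\<le>k. X t \<omega> = w t} \<omega> *\<^sub>R G w)"
proof -
  define w0 where "w0 = restrict (\<lambda>t. X t \<omega>) {..k}"
  have eq: "indicat_real {\<omega>\<in>space M. \<forall>t\<le>k. X t \<omega> = w t} \<omega> *\<^sub>R G w
      = (if w = w0 then G (\<lambda>t. X t \<omega>) else 0)"
    if w: "w \<in> PiE {..k} (\<lambda>_. UNIV)" for w
  proof (cases "\<forall>t\<le>k. X t \<omega> = w t")
    case True
    then have "w = w0"
      using w unfolding w0_def by (auto simp: PiE_def extensional_def)
    \<comment> \<open>Beyond \<open>k\<close> the representative \<open>w\<close> is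
      \<open>undefined\<close> and may differ from the actual path; \<open>dep\<close> makes
      \<open>G\<close> blind to this.\<close>
    moreover have "G w = G (\<lambda>t. X t \<omega>)"
      using True dep by simp
    ultimately show ?thesis
      using True assms(1) by (auto simp: w0_def)
  next
    case False
    then have "w \<noteq> w0"
      by (auto simp: w0_def)
    with False show ?thesis
      by (auto simp: indicator_def)
  qed
  have "w0 \<in> PiE {..k} (\<lambda>_. UNIV)"
    by (auto simp: w0_def)
  then show ?thesis
    by (simp add: eq finite_paths cong: sum.cong)
qed

lemma path_cylinder_measurable:
  fixes X :: "nat \<Rightarrow> 'w \<Rightarrow> 's::finite"
  assumes [measurable]: "\<And>t. X t \<in> measurable M (count_space UNIV)"
  shows "{\<omega>\<in>space M. \<forall>t\<le>(k::nat). X t \<omega> = w t} \<in> sets M"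
  by measurable

text \<open>By the decomposition, the integrand is a finite combination of indicators of measurable
  sets of finite measure.\<close>

lemma integrable_path_function:
  fixes X :: "nat \<Rightarrow> 'w \<Rightarrow> 's::finite"
    and G :: "(nat \<Rightarrow> 's) \<Rightarrow> 'b::{banach, second_countable_topology}"
  assumes "finite_measure M" and "\<And>t. X t \<in> measurable M (count_space UNIV)"
    and dep: "\<forall>u v. (\<forall>t\<le>k. u t = v t) \<longrightarrow> G u = G v"
  shows "integrable M (\<lambda>\<omega>. G (\<lambda>t. X t \<omega>))"
proof -
  interpret finite_measure M by fact
  have "integrable M (\<lambda>\<omega>. \<Sum>w\<in>PiE {..k} (\<lambda>_. UNIV).
      indicat_real {\<omega>\<in>space M. \<forall>t\<le>k. X t \<omega> = w t} \<omega> *\<^sub>R G w)"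
  proof (rule Bochner_Integration.integrable_sum)
    fix w :: "nat \<Rightarrow> 's"
    have "integrable M (indicat_real {\<omega>\<in>space M. \<forall>t\<le>k. X t \<omega> = w t})"
      by (rule integrable_real_indicator[OF path_cylinder_measurable[OF assms(2)]])
         (simp add: emeasure_eq_measure)
    then show "integrable M (\<lambda>\<omega>.
        indicat_real {\<omega>\<in>space M. \<forall>t\<le>k. X t \<omega> = w t} \<omega> *\<^sub>R G w)"
      by (rule integrable_scaleR_left)
  qed
  moreover have "integrable M (\<lambda>\<omega>. G (\<lambda>t. X t \<omega>)) \<longleftrightarrow>
      integrable M (\<lambda>\<omega>. \<Sum>w\<in>PiE {..k} (\<lambda>_. UNIV).
        indicat_real {\<omega>\<in>space M. \<forall>t\<le>k. X t \<omega> = w t} \<omega> *\<^sub>R G w)"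
    by (intro Bochner_Integration.integrable_cong refl
        path_function_decomposition[where X = X, OF _ dep])
  ultimately show ?thesis
    by (rule iffD2[rotated])
qed

section \<open>The Markov property for functions of the past\<close>

text \<open>\<open>is_dtmc\<close> prescribes transition probabilities given a single history.
  Expanding \<open>G\<close> over all histories and summing extends this to any function of the
  past.\<close>

lemma dtmc_markov_property:
  fixes X :: "nat \<Rightarrow> 'w \<Rightarrow> 's::finite" and G :: "(nat \<Rightarrow> 's) \<Rightarrow> real"
  assumes dtmc: "is_dtmc M X s0 P"
    and dep: "\<forall>u v. (\<forall>t\<le>k. u t = v t) \<longrightarrow> G u = G v"
  shows "(\<integral>\<omega>. G (\<lambda>t. X t \<omega>) * of_bool (X (Suc k) \<omega> = j) \<partial>M)
       = (\<integral>\<omega>. G (\<lambda>t. X t \<omega>) * P (X k \<omega>) j \<partial>M)"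
proof -
  interpret prob_space M
    using dtmc by (simp add: is_dtmc_def)
  have X: "X t \<in> measurable M (count_space UNIV)" for t
    using dtmc by (simp add: is_dtmc_def)
  note [measurable] = X
  define W where "W = (PiE {..k} (\<lambda>_. UNIV) :: (nat \<Rightarrow> 's) set)"
  define C where "C w = {\<omega>\<in>space M. \<forall>t\<le>k. X t \<omega> = w t}" for w
  define N where "N = {\<omega>\<in>space M. X (Suc k) \<omega> = j}"
  have [measurable]: "C w \<in> sets M" for w
    unfolding C_def by measurable
  have [measurable]: "N \<in> sets M"
    unfolding N_def by measurable
  \<comment> \<open>In product form the transition law also covers histories of probability zero,
    where the conditional law in \<open>is_dtmc\<close> is silent: there both sides vanish.\<close>
  have transition: "prob (C w \<inter> N) = prob (C w) * P (w k) j" for w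
  proof (cases "prob (C w) = 0")
    case True
    then have "prob (C w \<inter> N) = 0"
      using finite_measure_mono[of "C w \<inter> N" "C w"] measure_nonneg[of M "C w \<inter> N"] by auto
    with True show ?thesis by simp
  next
    case False
    \<comment> \<open>\<open>is_dtmc\<close> reads history and successor off one function. Setting
      the value at \<open>Suc k\<close> to \<open>j\<close> leaves the cylinder \<open>C w\<close>
      unchanged, as it only looks at times up to \<open>k\<close>.\<close>
    define v where "v = w(Suc k := j)"
    have C: "C w = {\<omega>\<in>space M. \<forall>i\<le>k. X i \<omega> = v i}"
      by (auto simp: C_def v_def)
    have "\<P>(\<omega> in M. X (Suc k) \<omega> = v (Suc k) \<bar> \<forall>i\<le>k. X i \<omega> = v i) = P (v k) (v (Suc k))"
      using dtmc False unfolding is_dtmc_def C by blast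
    moreover have "{\<omega>\<in>space M. X (Suc k) \<omega> = v (Suc k) \<and> (\<forall>i\<le>k. X i \<omega> = v i)} = C w \<inter> N"
      by (auto simp: C N_def v_def)
    ultimately show ?thesis
      using False by (simp add: cond_prob_def flip: C) (simp add: v_def field_simps)
  qed
  have "(\<integral>\<omega>. G (\<lambda>t. X t \<omega>) * of_bool (X (Suc k) \<omega> = j) \<partial>M)
      = (\<integral>\<omega>. (\<Sum>w\<in>W. indicat_real (C w \<inter> N) \<omega> * G w) \<partial>M)"
  proof (rule Bochner_Integration.integral_cong[OF refl])
    fix \<omega> assume \<omega>: "\<omega> \<in> space M"
    have "G (\<lambda>t. X t \<omega>) = (\<Sum>w\<in>W. indicat_real (C w) \<omega> * G w)"
      using path_function_decomposition[where X = X, OF \<omega> dep] by (simp add: W_def C_def)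
    moreover have "of_bool (X (Suc k) \<omega> = j) = indicat_real N \<omega>"
      using \<omega> by (simp add: N_def indicator_def)
    ultimately show "G (\<lambda>t. X t \<omega>) * of_bool (X (Suc k) \<omega> = j)
        = (\<Sum>w\<in>W. indicat_real (C w \<inter> N) \<omega> * G w)"
      by (simp add: sum_distrib_left indicator_inter_arith mult_ac)
  qed
  also have "\<dots> = (\<Sum>w\<in>W. prob (C w \<inter> N) * G w)"
    by (subst Bochner_Integration.integral_sum) (auto simp: emeasure_eq_measure)
  also have "\<dots> = (\<Sum>w\<in>W. prob (C w) * (G w * P (w k) j))"
    by (simp add: transition mult_ac)
  also have "\<dots> = (\<integral>\<omega>. (\<Sum>w\<in>W. indicat_real (C w) \<omega> * (G w * P (w k) j)) \<partial>M)"
    by (subst Bochner_Integration.integral_sum) (auto simp: emeasure_eq_measure)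
  also have "\<dots> = (\<integral>\<omega>. G (\<lambda>t. X t \<omega>) * P (X k \<omega>) j \<partial>M)"
  proof (rule Bochner_Integration.integral_cong[OF refl])
    fix \<omega> assume \<omega>: "\<omega> \<in> space M"
    \<comment> \<open>The new integrand again depends only on modes up to \<open>k\<close>, so the
      same decomposition, read backwards, reassembles the sum.\<close>
    have "\<forall>u v. (\<forall>t\<le>k. u t = v t) \<longrightarrow> G u * P (u k) j = G v * P (v k) j"
    proof (intro allI impI)
      fix u v :: "nat \<Rightarrow> 's"
      assume uv: "\<forall>t\<le>k. u t = v t"
      then have "G u = G v"
        using dep by blast
      with uv show "G u * P (u k) j = G v * P (v k) j"
        by simp
    qed
    from path_function_decomposition[where G = "\<lambda>u. G u * P (u k) j" and X = X, OF \<omega> this]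
    show "(\<Sum>w\<in>W. indicat_real (C w) \<omega> * (G w * P (w k) j)) = G (\<lambda>t. X t \<omega>) * P (X k \<omega>) j"
      by (simp add: W_def C_def)
  qed
  finally show ?thesis .
qed

section \<open>Mode-wise second moments: recursion and decay\<close>

text \<open>The quadratic form of the matrix E[x(k) x(k)'; s_k = j]. Splitting by the current mode
  closes the recursion, since the next matrix depends on that mode; using forms instead of matrices
  reduces comparisons to real inequalities.\<close>

definition mode_moment ::
    "'w measure \<Rightarrow> (nat \<Rightarrow> 'w \<Rightarrow> 's) \<Rightarrow> ('s \<Rightarrow> real^'n^'n) \<Rightarrow> real^'n \<Rightarrow> nat \<Rightarrow> 's \<Rightarrow> real^'n \<Rightarrow> real"
  where
  "mode_moment M X A x0 k j y =
     (\<integral>\<omega>. (y \<bullet> jls_state A (\<lambda>t. X t \<omega>) x0 k)\<^sup>2 * of_bool (X k \<omega> = j) \<partial>M)"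

lemma integrable_mode_moment:
  fixes X :: "nat \<Rightarrow> 'w \<Rightarrow> 's::finite"
  assumes "finite_measure M" and "\<And>t. X t \<in> measurable M (count_space UNIV)"
  shows "integrable M
    (\<lambda>\<omega>. (y \<bullet> jls_state A (\<lambda>t. X t \<omega>) x0 k)\<^sup>2 * of_bool (X k \<omega> = j))"
proof (rule integrable_path_function[OF assms,
      where G = "\<lambda>u. (y \<bullet> jls_state A u x0 k)\<^sup>2 * of_bool (u k = j)" and k = k], intro allI impI)
  fix u v :: "nat \<Rightarrow> 's"
  assume uv: "\<forall>t\<le>k. u t = v t"
  then have "jls_state A u x0 k = jls_state A v x0 k"
    by (intro jls_state_cong) auto
  with uv show "(y \<bullet> jls_state A u x0 k)\<^sup>2 * of_bool (u k = j)
      = (y \<bullet> jls_state A v x0 k)\<^sup>2 * of_bool (v k = j)"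
    by simp
qed

text \<open>The Markov property replaces the indicator of the next mode \<open>j\<close> by
  \<open>P (X k \<omega>) j\<close>. Splitting by the current mode \<open>i\<close> makes the last
  matrix factor the constant \<open>A i\<close>, which passes to \<open>y\<close> as its
  transpose.\<close>

lemma mode_moment_Suc:
  fixes X :: "nat \<Rightarrow> 'w \<Rightarrow> 's::finite"
  assumes dtmc: "is_dtmc M X s0 P"
  shows "mode_moment M X A x0 (Suc k) j y
    = (\<Sum>i\<in>UNIV. P i j * mode_moment M X A x0 k i (transpose (A i) *v y))"
proof -
  interpret prob_space M
    using dtmc by (simp add: is_dtmc_def)
  have X: "X t \<in> measurable M (count_space UNIV)" for t
    using dtmc by (simp add: is_dtmc_def)
  \<comment> \<open>The state at time \<open>Suc k\<close> involves only the modes at times 0 to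
    \<open>k\<close>; hence it counts as past relative to \<open>X (Suc k)\<close>.\<close>
  have "jls_state A u x0 (Suc k) = jls_state A v x0 (Suc k)" if "\<forall>t\<le>k. u t = v t" for u v
    using that by (intro jls_state_cong) simp
  then have dep: "\<forall>u v. (\<forall>t\<le>k. u t = v t) \<longrightarrow>
      (y \<bullet> jls_state A u x0 (Suc k))\<^sup>2 = (y \<bullet> jls_state A v x0 (Suc k))\<^sup>2"
    by metis
  have "mode_moment M X A x0 (Suc k) j y
      = (\<integral>\<omega>. (y \<bullet> jls_state A (\<lambda>t. X t \<omega>) x0 (Suc k))\<^sup>2 * P (X k \<omega>) j \<partial>M)"
    unfolding mode_moment_def
    by (rule dtmc_markov_property[OF dtmc,
          where G = "\<lambda>u. (y \<bullet> jls_state A u x0 (Suc k))\<^sup>2", OF dep])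
  also have "\<dots> = (\<integral>\<omega>. (\<Sum>i\<in>UNIV. P i j *
      (((transpose (A i) *v y) \<bullet> jls_state A (\<lambda>t. X t \<omega>) x0 k)\<^sup>2 * of_bool (X k \<omega> = i))) \<partial>M)"
  proof (rule Bochner_Integration.integral_cong[OF refl])
    fix \<omega>
    have "(\<Sum>i\<in>UNIV. P i j *
        (((transpose (A i) *v y) \<bullet> jls_state A (\<lambda>t. X t \<omega>) x0 k)\<^sup>2 * of_bool (X k \<omega> = i)))
      = (\<Sum>i\<in>UNIV. if i = X k \<omega>
          then P i j * ((transpose (A i) *v y) \<bullet> jls_state A (\<lambda>t. X t \<omega>) x0 k)\<^sup>2 else 0)"
      by (intro sum.cong) auto
    then show "(y \<bullet> jls_state A (\<lambda>t. X t \<omega>) x0 (Suc k))\<^sup>2 * P (X k \<omega>) j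
      = (\<Sum>i\<in>UNIV. P i j *
        (((transpose (A i) *v y) \<bullet> jls_state A (\<lambda>t. X t \<omega>) x0 k)\<^sup>2 * of_bool (X k \<omega> = i)))"
      by (simp add: dot_lmul_matrix mult.commute)
  qed
  also have "\<dots> = (\<Sum>i\<in>UNIV. P i j * mode_moment M X A x0 k i (transpose (A i) *v y))"
    unfolding mode_moment_def
    by (subst Bochner_Integration.integral_sum)
       (auto intro!: integrable_mult_right integrable_mode_moment X finite_measure_axioms
         simp del: of_bool_eq_iff)
  finally show ?thesis .
qed

text \<open>Induction on \<open>k\<close>: nonnegativity of \<open>P\<close> makes the recursion
  monotone, and \<open>contract\<close> contributes one factor \<open>\<rho>\<close> per step. The
  claim stays general in \<open>j\<close> and \<open>y\<close>, because the recursion evaluates all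
  modes at transformed vectors.\<close>

lemma mode_moment_le_geometric:
  fixes X :: "nat \<Rightarrow> 'w \<Rightarrow> 's::finite" and A :: "'s \<Rightarrow> real^'n^'n"
  assumes dtmc: "is_dtmc M X s0 P"
    and P_nonneg: "\<And>i j. 0 \<le> P i j"
    and \<alpha>_pos: "\<And>i. 0 < \<alpha> i" and "0 \<le> \<rho>"
    and contract: "\<And>j y. (\<Sum>i\<in>UNIV. P i j * (\<alpha> i *
        ((transpose (A i) *v y) \<bullet> (transpose (A i) *v y)))) \<le> \<rho> * (\<alpha> j * (y \<bullet> y))"
  obtains c where "\<And>k j y. mode_moment M X A x0 k j y \<le> c * \<rho> ^ k * (\<alpha> j * (y \<bullet> y))"
proof
  interpret prob_space M
    using dtmc by (simp add: is_dtmc_def)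
  have X: "X t \<in> measurable M (count_space UNIV)" for t
    using dtmc by (simp add: is_dtmc_def)
  \<comment> \<open>\<open>m\<close> and \<open>c\<close> are chosen for the case k = 0: the
    indicator is at most 1, and by Cauchy-Schwarz (y . x0)^2 <= |x0|^2 |y|^2 = c m |y|^2, which is
    at most c |y|^2 times any weight \<open>\<alpha> j\<close>.\<close>
  define m where "m = Min (range \<alpha>)"
  have m: "0 < m" "m \<le> \<alpha> j" for j
    using \<alpha>_pos by (auto simp: m_def)
  define c where "c = (x0 \<bullet> x0) / m"
  have c: "0 \<le> c"
    using m by (simp add: c_def)
  show "mode_moment M X A x0 k j y \<le> c * \<rho> ^ k * (\<alpha> j * (y \<bullet> y))" for k j y
  proof (induction k arbitrary: j y)
    case 0
    have "mode_moment M X A x0 0 j y \<le> (\<integral>\<omega>. (y \<bullet> x0)\<^sup>2 \<partial>M)"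
      unfolding mode_moment_def
      using integrable_mode_moment[where X = X and k = 0 and A = A, OF finite_measure_axioms X]
      by (intro integral_mono) auto
    also have "\<dots> \<le> (x0 \<bullet> x0) * (y \<bullet> y)"
      using Cauchy_Schwarz_ineq[of y x0] by (simp add: prob_space mult.commute)
    also have "\<dots> = c * (m * (y \<bullet> y))"
      using m by (simp add: c_def)
    also have "\<dots> \<le> c * (\<alpha> j * (y \<bullet> y))"
      using c m by (intro mult_left_mono mult_right_mono) auto
    finally show ?case by simp
  next
    case (Suc k)
    have "mode_moment M X A x0 (Suc k) j y
        = (\<Sum>i\<in>UNIV. P i j * mode_moment M X A x0 k i (transpose (A i) *v y))"
      by (rule mode_moment_Suc[OF dtmc])
    also have "\<dots> \<le> (\<Sum>i\<in>UNIV. P i j * (c * \<rho> ^ k *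
        (\<alpha> i * ((transpose (A i) *v y) \<bullet> (transpose (A i) *v y)))))"
      by (intro sum_mono mult_left_mono Suc.IH P_nonneg)
    also have "\<dots> = c * \<rho> ^ k * (\<Sum>i\<in>UNIV. P i j *
        (\<alpha> i * ((transpose (A i) *v y) \<bullet> (transpose (A i) *v y))))"
      unfolding sum_distrib_left by (intro sum.cong refl) (simp only: mult_ac)
    also have "\<dots> \<le> c * \<rho> ^ k * (\<rho> * (\<alpha> j * (y \<bullet> y)))"
      using c \<open>0 \<le> \<rho>\<close> by (intro mult_left_mono contract) auto
    finally show ?case
      by (simp add: mult_ac)
  qed
qed

section \<open>From mode-wise decay to mean-square stability\<close>

text \<open>Summing the moments over all modes at a unit vector gives a diagonal entry of
  E[x(k) x(k)']. Diagonal entries control the others, and a row sum has \<open>CARD('n)\<close>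
  terms.\<close>

lemma mean_square_stable_of_geometric:
  fixes X :: "nat \<Rightarrow> 'w \<Rightarrow> 's::finite" and A :: "'s \<Rightarrow> real^'n^'n"
  assumes "finite_measure M" and X: "\<And>t. X t \<in> measurable M (count_space UNIV)"
    and \<rho>: "0 \<le> \<rho>" "\<rho> < 1"
    and bound: "\<And>x0. \<exists>c. \<forall>k j y. mode_moment M X A x0 k j y \<le> c * \<rho> ^ k * (\<alpha> j * (y \<bullet> y))"
  shows "mean_square_stable M X A"
  unfolding mean_square_stable_def Let_def
proof
  fix x0 :: "real^'n"
  interpret finite_measure M by fact
  obtain c where c: "\<And>k j y. mode_moment M X A x0 k j y \<le> c * \<rho> ^ k * (\<alpha> j * (y \<bullet> y))"
    using bound by metis
  let ?x = "\<lambda>k \<omega>. jls_state A (\<lambda>t. X t \<omega>) x0 k"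
  \<comment> \<open>The codomain of \<open>g\<close> is left open so that this covers both the
    matrix-valued integral and its scalar entries.\<close>
  have integrable: "integrable M (\<lambda>\<omega>. g (?x k \<omega>))"
    for k and g :: "real^'n \<Rightarrow> 'c::{banach, second_countable_topology}"
  proof (rule integrable_path_function[where X = X, OF finite_measure_axioms X,
        where G = "\<lambda>u. g (jls_state A u x0 k)" and k = k], intro allI impI)
    fix u v :: "nat \<Rightarrow> 's"
    assume "\<forall>t\<le>k. u t = v t"
    then have "jls_state A u x0 k = jls_state A v x0 k"
      by (intro jls_state_cong) simp
    then show "g (jls_state A u x0 k) = g (jls_state A v x0 k)"
      by simp
  qed
  define Q where "Q k = (\<integral>\<omega>. outer_product (?x k \<omega>) (?x k \<omega>) \<partial>M)" for k
  have Q_entry: "Q k $ a $ b = (\<integral>\<omega>. ?x k \<omega> $ a * ?x k \<omega> $ b \<partial>M)" for k a b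
  proof -
    \<comment> \<open>Entry extraction is bounded linear and therefore commutes with the
      matrix-valued Bochner integral.\<close>
    have "bounded_linear (\<lambda>B::real^'n^'n. B $ a $ b)"
      using bounded_linear_compose[OF bounded_linear_vec_nth bounded_linear_vec_nth] .
    from integral_bounded_linear[OF this integrable[of "\<lambda>x. outer_product x x"]]
    show ?thesis
      by (simp add: Q_def outer_product_def)
  qed
  define D where "D = c * (\<Sum>j\<in>UNIV. \<alpha> j)"
  have diagonal: "(\<integral>\<omega>. (?x k \<omega> $ a)\<^sup>2 \<partial>M) \<le> D * \<rho> ^ k" for k a
  proof -
    have "(\<integral>\<omega>. (?x k \<omega> $ a)\<^sup>2 \<partial>M)
        = (\<integral>\<omega>. (\<Sum>j\<in>UNIV. (axis a 1 \<bullet> ?x k \<omega>)\<^sup>2 * of_bool (X k \<omega> = j)) \<partial>M)"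
    proof (rule Bochner_Integration.integral_cong[OF refl])
      fix \<omega>
      have "(\<Sum>j\<in>UNIV. of_bool (X k \<omega> = j)) = (1::real)"
        by (simp add: of_bool_def)
      then show "(?x k \<omega> $ a)\<^sup>2 = (\<Sum>j\<in>UNIV. (axis a 1 \<bullet> ?x k \<omega>)\<^sup>2 * of_bool (X k \<omega> = j))"
        by (simp add: inner_axis' flip: sum_distrib_left)
    qed
    also have "\<dots> = (\<Sum>j\<in>UNIV. mode_moment M X A x0 k j (axis a 1))"
      unfolding mode_moment_def
      by (intro Bochner_Integration.integral_sum integrable_mode_moment X finite_measure_axioms)
    also have "\<dots> \<le> (\<Sum>j\<in>UNIV. c * \<rho> ^ k * (\<alpha> j * ((axis a 1 :: real^'n) \<bullet> axis a 1)))"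
      by (intro sum_mono c)
    also have "\<dots> = D * \<rho> ^ k"
      by (simp add: D_def inner_axis_axis sum_distrib_left mult_ac)
    finally show ?thesis .
  qed
  have entry: "\<bar>Q k $ a $ b\<bar> \<le> D * \<rho> ^ k" for k a b
  proof -
    have "\<bar>Q k $ a $ b\<bar> \<le> (\<integral>\<omega>. \<bar>?x k \<omega> $ a * ?x k \<omega> $ b\<bar> \<partial>M)"
      unfolding Q_entry by (rule integral_abs_bound)
    \<comment> \<open>The arithmetic-geometric mean inequality, applied pointwise, reduces every
      entry to diagonal ones.\<close>
    also have "\<dots> \<le> (\<integral>\<omega>. ((?x k \<omega> $ a)\<^sup>2 + (?x k \<omega> $ b)\<^sup>2) / 2 \<partial>M)"
    proof (rule integral_mono)
      fix \<omega>
      show "\<bar>?x k \<omega> $ a * ?x k \<omega> $ b\<bar> \<le> ((?x k \<omega> $ a)\<^sup>2 + (?x k \<omega> $ b)\<^sup>2) / 2"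
        using sum_squares_bound[of "\<bar>?x k \<omega> $ a\<bar>" "\<bar>?x k \<omega> $ b\<bar>"] by (simp add: abs_mult)
    qed (rule integrable[of "\<lambda>x. \<bar>x $ a * x $ b\<bar>"],
         rule integrable[of "\<lambda>x. ((x $ a)\<^sup>2 + (x $ b)\<^sup>2) / 2"])
    also have "\<dots> = ((\<integral>\<omega>. (?x k \<omega> $ a)\<^sup>2 \<partial>M) + (\<integral>\<omega>. (?x k \<omega> $ b)\<^sup>2 \<partial>M)) / 2"
      by (simp add: integrable[of "\<lambda>x. (x $ a)\<^sup>2"] integrable[of "\<lambda>x. (x $ b)\<^sup>2"])
    also have "\<dots> \<le> D * \<rho> ^ k"
      using diagonal[of k a] diagonal[of k b] by simp
    finally show ?thesis .
  qed
  have norm_bounds: "0 \<le> matrix_norm_inf (Q k)"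
      "matrix_norm_inf (Q k) \<le> real CARD('n) * D * \<rho> ^ k" for k
  proof -
    have "(\<Sum>b\<in>UNIV. \<bar>Q k $ a $ b\<bar>) \<le> real CARD('n) * D * \<rho> ^ k" for a
      using sum_bounded_above[of UNIV "\<lambda>b. \<bar>Q k $ a $ b\<bar>", OF entry] by (simp add: mult.assoc)
    then show "matrix_norm_inf (Q k) \<le> real CARD('n) * D * \<rho> ^ k"
      by (simp add: matrix_norm_inf_def)
    have "0 \<le> (\<Sum>b\<in>UNIV. \<bar>Q k $ a $ b\<bar>)" for a
      by (simp add: sum_nonneg)
    then show "0 \<le> matrix_norm_inf (Q k)"
      by (simp add: matrix_norm_inf_def Max_ge_iff)
  qed
  have "(\<lambda>k. real CARD('n) * D * \<rho> ^ k) \<longlonglongrightarrow> real CARD('n) * D * 0"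
    using \<rho> by (intro tendsto_mult_left LIMSEQ_realpow_zero)
  then have "(\<lambda>k. real CARD('n) * D * \<rho> ^ k) \<longlonglongrightarrow> 0"
    by simp
  then have "(\<lambda>k. matrix_norm_inf (Q k)) \<longlonglongrightarrow> 0"
    by (rule tendsto_sandwich[OF _ _ tendsto_const, rotated 2]) (auto simp: norm_bounds)
  then show "(\<lambda>k. matrix_norm_inf (\<integral>\<omega>. outer_product (?x k \<omega>) (?x k \<omega>) \<partial>M)) \<longlonglongrightarrow> 0"
    by (simp add: Q_def)
qed

section \<open>A uniform contraction factor from the Lyapunov inequality\<close>

lemma pos_def_diff_contraction:
  fixes B :: "'s::finite \<Rightarrow> real^'n^'n"
  assumes \<alpha>_pos: "\<And>j. 0 < \<alpha> j" and pd: "\<And>j. pos_def (\<alpha> j *\<^sub>R mat 1 - B j)"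
  obtains \<rho> where "0 \<le> \<rho>" "\<rho> < 1" "\<And>j y. y \<bullet> (B j *v y) \<le> \<rho> * (\<alpha> j * (y \<bullet> y))"
proof -
  have "\<exists>d>0. \<forall>y. d * (y \<bullet> y) \<le> y \<bullet> ((\<alpha> j *\<^sub>R mat 1 - B j) *v y)" for j
    using pos_def_coercive[OF pd] by metis
  then obtain d where d: "\<And>j. 0 < d j"
      "\<And>j y. d j * (y \<bullet> y) \<le> y \<bullet> ((\<alpha> j *\<^sub>R mat 1 - B j) *v y)"
    by metis
  \<comment> \<open>Coercivity gives the form of \<open>B j\<close> the bound (1 - d_j / \<alpha>_j)
    \<alpha>_j |y|^2; the least relative slack over the finitely many modes serves them all.\<close>
  define e where "e = Min (range (\<lambda>j. d j / \<alpha> j))"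
  have e: "0 < e" and e_le: "e \<le> d j / \<alpha> j" for j
    using d \<alpha>_pos by (auto simp: e_def)
  show thesis
  proof
    \<comment> \<open>For arbitrary \<open>B\<close> the number 1 - e may be negative; cutting it
      off at 0 keeps the powers of the factor nonnegative.\<close>
    show "0 \<le> max 0 (1 - e)" "max 0 (1 - e) < 1"
      using e by auto
    fix j and y :: "real^'n"
    have "e * \<alpha> j \<le> d j"
      using e_le[of j] \<alpha>_pos[of j] by (simp add: field_simps)
    then have "e * \<alpha> j * (y \<bullet> y) \<le> d j * (y \<bullet> y)"
      by (intro mult_right_mono) auto
    also have "\<dots> \<le> \<alpha> j * (y \<bullet> y) - y \<bullet> (B j *v y)"
      using d(2)[of j y]
      by (simp add: matrix_vector_mult_diff_rdistrib inner_diff_right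
          flip: scaleR_matrix_vector_assoc)
    finally have "y \<bullet> (B j *v y) \<le> (1 - e) * (\<alpha> j * (y \<bullet> y))"
      by (simp add: algebra_simps)
    also have "\<dots> \<le> max 0 (1 - e) * (\<alpha> j * (y \<bullet> y))"
      using \<alpha>_pos[of j] by (intro mult_right_mono) auto
    finally show "y \<bullet> (B j *v y) \<le> max 0 (1 - e) * (\<alpha> j * (y \<bullet> y))" .
  qed
qed

section \<open>Stability under the policy obtained from the certificate\<close>

theorem theorem3:
  fixes s0 :: "'s::finite"
    and avail :: "'s \<Rightarrow> 'a::finite set"
    and T :: "'s \<Rightarrow> 'a \<Rightarrow> 's \<Rightarrow> real"
    and A :: "'s \<Rightarrow> real^'n^'n"
    and \<alpha> :: "'s \<Rightarrow> real"
    and K :: "'s \<Rightarrow> 'a \<Rightarrow> real"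
    and V :: "'s \<Rightarrow> real^'n^'n"
    and \<pi> :: "'s \<Rightarrow> 'a \<Rightarrow> real"
  assumes mdp: "is_mdp avail T"
    and alpha_pos: "\<And>i. \<alpha> i > 0"
    and K_nonneg: "\<And>i \<sigma>. K i \<sigma> \<ge> 0"
    and K_unavail: "\<And>i \<sigma>. \<sigma> \<notin> avail i \<Longrightarrow> K i \<sigma> = 0"
    and V_eq: "\<And>i. V i = \<alpha> i *\<^sub>R mat 1"
    and lyapunov: "\<And>j. pos_def (V j -
          (\<Sum>i\<in>UNIV. \<Sum>\<sigma>\<in>UNIV. (T i \<sigma> j * K i \<sigma>) *\<^sub>R (A i ** transpose (A i))))"
    and K_sum: "\<And>i. (\<Sum>\<sigma>\<in>UNIV. K i \<sigma>) = \<alpha> i"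
    and pi_eq: "\<And>i \<sigma>. \<pi> i \<sigma> = K i \<sigma> / \<alpha> i"
  shows "is_policy avail \<pi> \<and>
    (\<forall>(M :: 'w measure) X. is_dtmc M X s0 (induced_transition T \<pi>) \<longrightarrow>
       mean_square_stable M X A)"
proof (intro conjI allI impI)
  have K_le: "K i \<sigma> \<le> \<alpha> i" for i \<sigma>
    using member_le_sum[of \<sigma> UNIV "K i"] K_nonneg by (simp add: K_sum)
  have "(\<Sum>\<sigma>\<in>UNIV. \<pi> i \<sigma>) = 1" for i
    using alpha_pos[of i] by (simp add: pi_eq K_sum flip: sum_divide_distrib)
  then show "is_policy avail \<pi>"
    using K_le K_nonneg K_unavail alpha_pos
    by (auto simp: is_policy_def pi_eq less_imp_le intro!: divide_nonneg_pos)
  fix M :: "'w measure" and X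
  let ?P = "induced_transition T \<pi>"
  assume dtmc: "is_dtmc M X s0 ?P"
  define B where "B j = (\<Sum>i\<in>UNIV. \<Sum>\<sigma>\<in>UNIV.
      (T i \<sigma> j * K i \<sigma>) *\<^sub>R (A i ** transpose (A i)))" for j
  have B_form: "y \<bullet> (B j *v y) = (\<Sum>i\<in>UNIV. ?P i j *
      (\<alpha> i * ((transpose (A i) *v y) \<bullet> (transpose (A i) *v y))))" for j and y :: "real^'n"
  proof -
    have "y \<bullet> (B j *v y) = (\<Sum>i\<in>UNIV. (\<Sum>\<sigma>\<in>UNIV. T i \<sigma> j * K i \<sigma>) *
        ((transpose (A i) *v y) \<bullet> (transpose (A i) *v y)))"
      by (simp add: B_def matrix_vector_mult_sum_left inner_sum_right inner_outer_square_mult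
          sum_distrib_right del: transpose_matrix_vector flip: scaleR_matrix_vector_assoc)
    \<comment> \<open>The choice of policy enters here:
      \<open>K i \<sigma> = \<pi> i \<sigma> * \<alpha> i\<close>, so the sum over actions becomes
      the induced transition probability times the weight.\<close>
    moreover have "(\<Sum>\<sigma>\<in>UNIV. T i \<sigma> j * K i \<sigma>) = ?P i j * \<alpha> i" for i
      using alpha_pos[of i] by (simp add: induced_transition_def pi_eq sum_distrib_right)
    ultimately show ?thesis
      by (simp add: mult.assoc)
  qed
  obtain \<rho> where \<rho>: "0 \<le> \<rho>" "\<rho> < 1" "\<And>j y. y \<bullet> (B j *v y) \<le> \<rho> * (\<alpha> j * (y \<bullet> y))"
    using pos_def_diff_contraction[of \<alpha> B] alpha_pos lyapunov unfolding V_eq B_def by blast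
  have P_nonneg: "0 \<le> ?P i j" for i j
    using mdp K_nonneg alpha_pos
    by (auto simp: induced_transition_def is_mdp_def pi_eq less_imp_le
        intro!: sum_nonneg mult_nonneg_nonneg divide_nonneg_pos)
  show "mean_square_stable M X A"
  proof (rule mean_square_stable_of_geometric[OF _ _ \<rho>(1,2)])
    show "finite_measure M" "\<And>t. X t \<in> measurable M (count_space UNIV)"
      using dtmc by (auto simp: is_dtmc_def prob_space_def)
    \<comment> \<open>Rewritten by \<open>B_form\<close>, the bound on \<open>B\<close> is the
      contraction hypothesis. Only \<open>c\<close> depends on \<open>x0\<close>; the rate
      \<open>\<rho>\<close> is fixed beforehand.\<close>
    show "\<exists>c. \<forall>k j y. mode_moment M X A x0 k j y \<le> c * \<rho> ^ k * (\<alpha> j * (y \<bullet> y))" for x0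
      using mode_moment_le_geometric[OF dtmc P_nonneg alpha_pos \<rho>(1) \<rho>(3)[unfolded B_form]]
      by metis
  qed
qed

end
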